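(* Let $\phi$ be a satisfiable frugal monodic standpoint $\mathcal{C}^2$ formula over the signature $\langle\mathbf{P},\emptyset,\{*\}\rangle$. Then there is a standpoint structure $\mathfrak{M}=\langle\Delta,\Pi,\sigma,\gamma\rangle$ over $\langle\mathbf{P}\uplus\mathbf{P}_{\mathtt{E}},\emptyset,\{*\}\rangle$, where $\mathbf{P}_{\mathtt{E}}$ is a set of fresh unary predicates that are rigid in $\mathfrak{M}$, with $|\mathbf{P}_{\mathtt{E}}|=\ell=|\mathit{FreeDia}_\phi|$ and $|\Pi|\le|\mathit{Dia}_\phi|\cdot 2^{|\mathit{Dia}_\phi|}$, such that the $\mathbf{P}_{\mathtt{E}}$-stable permutational closure $\langle\mathfrak{M}\rangle_{\mathbf{P}_{\mathtt{E}}}$ is a model of $\phi$.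
   Context: FOSL over a signature with only the universal standpoint $*$: formulae $\phi ::= P(t_1,\dots)\mid t_1\doteq t_2\mid\neg\phi\mid\phi\wedge\psi\mid\exists^{\lhd n}x.\phi\mid\Diamond_*\phi$. A standpoint structure $\langle\Delta,\Pi,\sigma,\gamma\rangle$ has nonempty domain $\Delta$, nonempty set of precisifications $\Pi$, $\sigma( * )=\Pi$, and $\gamma(\pi)$ a first-order structure over $\Delta$; $\Diamond_*\phi$ holds at $\pi$ under $v$ iff $\phi$ holds at some $\pi'\in\Pi$ under $v$; counting quantifiers are evaluated in the current precisification; a model satisfies the formula at all precisifications under all assignments. A predicate is rigid if its interpretation is the same in all precisifications; then $P^{\mathfrak{M}}$ denotes it. Frugal monodic standpoint $\mathcal{C}^2$: only variables $x,y$, only unary and binary predicates, no constants, only standpoint expression $*$, and in every subformula $\Diamond_*\psi$, $\psi$ has at most one free variable. $\mathit{Dia}_\phi$: subformulae of $\phi$ of the form $\Diamond_*\psi$; $\mathit{FreeDia}_\phi$: those with exactly one free variable. $\mathbf{P}_{\mathtt{E}}$-stable permutational closure: for $\mathfrak{M}=\langle\Delta,\Pi,\sigma,\gamma\rangle$ over $\langle\mathbf{P}\uplus\mathbf{P}_{\mathtt{E}},\emptyset,\{*\}\rangle$ with $\mathbf{P}$ unary/binary and $\mathbf{P}_{\mathtt{E}}$ rigid unary predicates, let $\mathbb{P}_{\mathtt{E}}$ be the set of bijections $f:\Delta\to\Delta$ with $\delta\in\mathtt{E}^{\mathfrak{M}}\Leftrightarrow f(\delta)\in\mathtt{E}^{\mathfrak{M}}$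 for all $\mathtt{E}\in\mathbf{P}_{\mathtt{E}}$, $\delta\in\Delta$. Then $\langle\mathfrak{M}\rangle_{\mathbf{P}_{\mathtt{E}}}=\langle\Delta,\Pi\times\mathbb{P}_{\mathtt{E}},\sigma',\gamma'\rangle$ with $\sigma'( * )=\Pi\times\mathbb{P}_{\mathtt{E}}$, $P^{\gamma'((\pi,f))}=\{f(\delta)\mid\delta\in P^{\gamma(\pi)}\}$ for unary $P\in\mathbf{P}$, and $P^{\gamma'((\pi,f))}=\{(f(\delta_1),f(\delta_2))\mid(\delta_1,\delta_2)\in P^{\gamma(\pi)}\}$ for binary $P\in\mathbf{P}$ (the rigid predicates of $\mathbf{P}_{\mathtt{E}}$ keep their interpretation, which is preserved by all $f\in\mathbb{P}_{\mathtt{E}}$).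
   Formalization: The bound on |Π| is replaced by max(1, |Dia_φ|·2^|Dia_φ|), because for a formula without diamonds the stated bound is 0 although Π must be nonempty; otherwise the bound is unchanged. *)

theory Defs
  imports Main "HOL-Library.FuncSet"
begin

text \<open>
  First-order standpoint logic with counting over signatures \<open>\<langle>\<^bold>P, {}, {*}\<rangle>\<close>: there are no
  constants, so every term is a variable, and \<open>*\<close> is the only standpoint expression.
\<close>

datatype cmp = AtMost | Exactly | AtLeast

datatype ('p, 'v) fm =
    Atom 'p "'v list"
  | Eq 'v 'v
  | Neg "('p, 'v) fm"
  | Conj "('p, 'v) fm" "('p, 'v) fm"
  | ExCount cmp nat 'v "('p, 'v) fm"
  | Diamond "('p, 'v) fm"

primrec fv :: "('p, 'v) fm \<Rightarrow> 'v set" where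
  "fv (Atom p ts) = set ts"
| "fv (Eq s t) = {s, t}"
| "fv (Neg \<phi>) = fv \<phi>"
| "fv (Conj \<phi> \<psi>) = fv \<phi> \<union> fv \<psi>"
| "fv (ExCount c n z \<phi>) = fv \<phi> - {z}"
| "fv (Diamond \<phi>) = fv \<phi>"

primrec vars :: "('p, 'v) fm \<Rightarrow> 'v set" where
  "vars (Atom p ts) = set ts"
| "vars (Eq s t) = {s, t}"
| "vars (Neg \<phi>) = vars \<phi>"
| "vars (Conj \<phi> \<psi>) = vars \<phi> \<union> vars \<psi>"
| "vars (ExCount c n z \<phi>) = insert z (vars \<phi>)"
| "vars (Diamond \<phi>) = vars \<phi>"

primrec subfms :: "('p, 'v) fm \<Rightarrow> ('p, 'v) fm set" where
  "subfms (Atom p ts) = {Atom p ts}"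
| "subfms (Eq s t) = {Eq s t}"
| "subfms (Neg \<phi>) = insert (Neg \<phi>) (subfms \<phi>)"
| "subfms (Conj \<phi> \<psi>) = insert (Conj \<phi> \<psi>) (subfms \<phi> \<union> subfms \<psi>)"
| "subfms (ExCount c n z \<phi>) = insert (ExCount c n z \<phi>) (subfms \<phi>)"
| "subfms (Diamond \<phi>) = insert (Diamond \<phi>) (subfms \<phi>)"

definition Dia :: "('p, 'v) fm \<Rightarrow> ('p, 'v) fm set" where
  "Dia \<phi> = {\<chi> \<in> subfms \<phi>. \<exists>\<psi>. \<chi> = Diamond \<psi>}"

definition FreeDia :: "('p, 'v) fm \<Rightarrow> ('p, 'v) fm set" where
  "FreeDia \<phi> = {\<chi> \<in> Dia \<phi>. card (fv \<chi>) = 1}"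

text \<open>
  A signature maps each of its predicate symbols to its arity; the symbols outside its domain
  are the ones that are fresh for it.
\<close>

type_synonym 'p sig = "'p \<rightharpoonup> nat"

definition add_unary :: "'p sig \<Rightarrow> 'p set \<Rightarrow> 'p sig" where
  "add_unary \<Sigma> E = (\<lambda>p. if p \<in> E then Some 1 else \<Sigma> p)"

primrec fm_over :: "'p sig \<Rightarrow> ('p, 'v) fm \<Rightarrow> bool" where
  "fm_over \<Sigma> (Atom p ts) \<longleftrightarrow> \<Sigma> p = Some (length ts)"
| "fm_over \<Sigma> (Eq s t) \<longleftrightarrow> True"
| "fm_over \<Sigma> (Neg \<phi>) \<longleftrightarrow> fm_over \<Sigma> \<phi>"
| "fm_over \<Sigma> (Conj \<phi> \<psi>) \<longleftrightarrow> fm_over \<Sigma> \<phi> \<and> fm_over \<Sigma> \<psi>"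
| "fm_over \<Sigma> (ExCount c n z \<phi>) \<longleftrightarrow> fm_over \<Sigma> \<phi>"
| "fm_over \<Sigma> (Diamond \<phi>) \<longleftrightarrow> fm_over \<Sigma> \<phi>"

definition monodic :: "('p, 'v) fm \<Rightarrow> bool" where
  "monodic \<phi> \<longleftrightarrow> (\<forall>\<psi>. Diamond \<psi> \<in> subfms \<phi> \<longrightarrow> card (fv \<psi>) \<le> 1)"

definition frugal_monodic_C2 :: "'p sig \<Rightarrow> 'v \<Rightarrow> 'v \<Rightarrow> ('p, 'v) fm \<Rightarrow> bool" where
  "frugal_monodic_C2 \<Sigma> x y \<phi> \<longleftrightarrow>
     ran \<Sigma> \<subseteq> {1, 2} \<and> fm_over \<Sigma> \<phi> \<and> vars \<phi> \<subseteq> {x, y} \<and> monodic \<phi>"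

text \<open>
  The component \<open>\<sigma>\<close> of a standpoint structure is determined by \<open>\<sigma>(*) = \<Pi>\<close> and is
  therefore left implicit. A \<open>k\<close>-ary relation is a set of lists of length \<open>k\<close>.
\<close>

record ('d, 'w, 'p) sstruct =
  domain :: "'d set"
  precs :: "'w set"
  interp :: "'w \<Rightarrow> 'p \<Rightarrow> 'd list set"

definition sstruct_over :: "'p sig \<Rightarrow> ('d, 'w, 'p) sstruct \<Rightarrow> bool" where
  "sstruct_over \<Sigma> M \<longleftrightarrow> domain M \<noteq> {} \<and> precs M \<noteq> {} \<and>
     (\<forall>\<pi>\<in>precs M. \<forall>p k. \<Sigma> p = Some k \<longrightarrow>
        interp M \<pi> p \<subseteq> {ds. length ds = k \<and> set ds \<subseteq> domain M})"

text \<open>An infinite set has more than \<open>n\<close> elements, although its \<open>card\<close> is \<open>0\<close>.\<close>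

fun has_count :: "cmp \<Rightarrow> nat \<Rightarrow> 'd set \<Rightarrow> bool" where
  "has_count AtMost n S \<longleftrightarrow> finite S \<and> card S \<le> n"
| "has_count Exactly n S \<longleftrightarrow> finite S \<and> card S = n"
| "has_count AtLeast n S \<longleftrightarrow> infinite S \<or> n \<le> card S"

primrec sat :: "('d, 'w, 'p) sstruct \<Rightarrow> 'w \<Rightarrow> ('v \<Rightarrow> 'd) \<Rightarrow> ('p, 'v) fm \<Rightarrow> bool" where
  "sat M \<pi> v (Atom p ts) \<longleftrightarrow> map v ts \<in> interp M \<pi> p"
| "sat M \<pi> v (Eq s t) \<longleftrightarrow> v s = v t"
| "sat M \<pi> v (Neg \<phi>) \<longleftrightarrow> \<not> sat M \<pi> v \<phi>"
| "sat M \<pi> v (Conj \<phi> \<psi>) \<longleftrightarrow> sat M \<pi> v \<phi> \<and> sat M \<pi> v \<psi>"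
| "sat M \<pi> v (ExCount c n z \<phi>) \<longleftrightarrow> has_count c n {d \<in> domain M. sat M \<pi> (v(z := d)) \<phi>}"
| "sat M \<pi> v (Diamond \<phi>) \<longleftrightarrow> (\<exists>\<pi>'\<in>precs M. sat M \<pi>' v \<phi>)"

definition models :: "('d, 'w, 'p) sstruct \<Rightarrow> ('p, 'v) fm \<Rightarrow> bool" where
  "models M \<phi> \<longleftrightarrow> (\<forall>\<pi>\<in>precs M. \<forall>v. range v \<subseteq> domain M \<longrightarrow> sat M \<pi> v \<phi>)"

text \<open>
  The type arguments are the universes from which domain and precisifications are drawn. HOL
  cannot quantify over types inside a formula; a theorem assuming satisfiability over type
  variables covers models over arbitrary universes.
\<close>

definition satisfiable :: "'d itself \<Rightarrow> 'w itself \<Rightarrow> 'p sig \<Rightarrow> ('p, 'v) fm \<Rightarrow> bool" where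
  "satisfiable _ _ \<Sigma> \<phi> \<longleftrightarrow> (\<exists>M :: ('d, 'w, 'p) sstruct. sstruct_over \<Sigma> M \<and> models M \<phi>)"

definition rigid :: "('d, 'w, 'p) sstruct \<Rightarrow> 'p \<Rightarrow> bool" where
  "rigid M p \<longleftrightarrow> (\<forall>\<pi>\<in>precs M. \<forall>\<pi>'\<in>precs M. interp M \<pi> p = interp M \<pi>' p)"

definition rigid_interp :: "('d, 'w, 'p) sstruct \<Rightarrow> 'p \<Rightarrow> 'd list set" where
  "rigid_interp M p = (THE R. \<forall>\<pi>\<in>precs M. interp M \<pi> p = R)"

text \<open>
  Extensionality makes functions on the domain unique as elements of the type \<open>'d \<Rightarrow> 'd\<close>.
\<close>

definition stable_perms :: "'p set \<Rightarrow> ('d, 'w, 'p) sstruct \<Rightarrow> ('d \<Rightarrow> 'd) set" where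
  "stable_perms PE M = {f \<in> extensional (domain M). bij_betw f (domain M) (domain M) \<and>
     (\<forall>E\<in>PE. \<forall>\<delta>\<in>domain M. [\<delta>] \<in> rigid_interp M E \<longleftrightarrow> [f \<delta>] \<in> rigid_interp M E)}"

definition perm_closure ::
  "'p set \<Rightarrow> ('d, 'w, 'p) sstruct \<Rightarrow> ('d, 'w \<times> ('d \<Rightarrow> 'd), 'p) sstruct" where
  "perm_closure PE M =
     \<lparr> domain = domain M,
       precs = precs M \<times> stable_perms PE M,
       interp = (\<lambda>(\<pi>, f) p. if p \<in> PE then rigid_interp M p else map f ` interp M \<pi> p) \<rparr>"

end

theory Submission
  imports Defs "HOL-Combinatorics.Transposition"
begin

text \<open>
  Take a model of \<open>\<phi>\<close> and call the set of diamond subformulae true at \<open>\<delta>\<close> the type of \<open>\<delta>\<close>.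
  One fresh rigid predicate per element of \<open>FreeDia \<phi>\<close> records the part of the type that
  depends on \<open>\<delta>\<close>, so the stable permutations are exactly the type-preserving ones. For every
  realised type \<open>S\<close> and every \<open>\<diamond>\<psi> \<in> S\<close>, keep a single precisification in which \<open>\<psi>\<close>
  holds at some element of type \<open>S\<close>. A transposition of that element with any other element of
  type \<open>S\<close> is stable, so in the permutational closure every element of type \<open>S\<close> has a
  witness for \<open>\<diamond>\<psi>\<close>.
\<close>

section \<open>Finiteness of syntactic sets, agreement of assignments, invariance of
  counting\<close>

lemma subfms_refl [simp]: "\<phi> \<in> subfms \<phi>"
  by (cases \<phi>) auto

lemma finite_subfms [simp]: "finite (subfms \<phi>)"
  by (induction \<phi>) auto

lemma finite_fv [simp]: "finite (fv \<phi>)"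
  by (induction \<phi>) auto

lemma finite_Dia [simp]: "finite (Dia \<phi>)"
  by (simp add: Dia_def)

lemma finite_FreeDia [simp]: "finite (FreeDia \<phi>)"
  by (simp add: FreeDia_def)

lemma sat_cong:
  assumes "\<And>z. z \<in> fv \<phi> \<Longrightarrow> u z = v z"
  shows "sat M \<pi> u \<phi> \<longleftrightarrow> sat M \<pi> v \<phi>"
  using assms
proof (induction \<phi> arbitrary: u v \<pi>)
  case (Atom p ts)
  then have "map u ts = map v ts" by simp
  then show ?case by (simp del: map_eq_conv)
next
  case (ExCount c n z \<phi>)
  have "sat M \<pi> (u(z := d)) \<phi> \<longleftrightarrow> sat M \<pi> (v(z := d)) \<phi>" for d
    by (rule ExCount.IH) (use ExCount.prems in auto)
  then show ?case by simp
next
  case (Diamond \<phi>)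
  have "sat M \<pi>' u \<phi> \<longleftrightarrow> sat M \<pi>' v \<phi>" for \<pi>'
    by (rule Diamond.IH) (use Diamond.prems in auto)
  then show ?case by simp
next
  case (Neg \<phi>)
  have "sat M \<pi> u \<phi> \<longleftrightarrow> sat M \<pi> v \<phi>"
    by (rule Neg.IH) (use Neg.prems in auto)
  then show ?case by simp
next
  case (Conj \<phi> \<psi>)
  have "sat M \<pi> u \<phi> \<longleftrightarrow> sat M \<pi> v \<phi>"
    by (rule Conj.IH(1)) (use Conj.prems in auto)
  moreover have "sat M \<pi> u \<psi> \<longleftrightarrow> sat M \<pi> v \<psi>"
    by (rule Conj.IH(2)) (use Conj.prems in auto)
  ultimately show ?case by simp
qed auto

lemma has_count_image:
  assumes "inj_on f S"
  shows "has_count c n (f ` S) \<longleftrightarrow> has_count c n S"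
  using assms by (cases c) (auto simp: card_image finite_image_iff)

section \<open>Rigid predicates and stable permutations\<close>

lemma rigid_interp_eq:
  assumes "precs M \<noteq> {}" "\<And>\<pi>. \<pi> \<in> precs M \<Longrightarrow> interp M \<pi> p = R"
  shows "rigid_interp M p = R"
  unfolding rigid_interp_def using assms by (intro the_equality) auto

text \<open>The transposition is its own inverse and moves only \<open>a\<close> and
  \<open>b\<close>, which no predicate of \<open>PE\<close> separates. Restriction meets the
  extensionality requirement of \<open>stable_perms\<close>.\<close>

lemma transpose_stable:
  assumes "a \<in> domain M" "b \<in> domain M"
    and "\<And>E. E \<in> PE \<Longrightarrow> [a] \<in> rigid_interp M E \<longleftrightarrow> [b] \<in> rigid_interp M E"
  shows "restrict (transpose a b) (domain M) \<in> stable_perms PE M"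
proof -
  have "bij_betw (transpose a b) (domain M) (domain M)"
    by (rule bij_betw_byWitness[where f' = "transpose a b"])
      (use assms in \<open>auto simp: transpose_def\<close>)
  then have "bij_betw (restrict (transpose a b) (domain M)) (domain M) (domain M)"
    by (simp cong: bij_betw_cong)
  then show ?thesis
    using assms by (auto simp: stable_perms_def transpose_def)
qed

section \<open>Transfer of truth to the permutational closure\<close>

text \<open>On the predicates of \<Sigma>, \<open>f\<close> is an isomorphism from the structure of
  \<open>M\<close> at \<open>\<pi>\<close> onto that of the closure at \<open>(\<pi>, f)\<close>,
  which settles all connectives except the diamond. The hypothesis \<open>dia\<close> isolates that
  case: its left side is a diamond of the closure, unfolded and pulled back along the new
  permutation \<open>g\<close>.\<close>

lemma sat_perm_closure:
  fixes M N :: "('d, 'w, 'p) sstruct"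
  assumes M: "sstruct_over \<Sigma> M" and fresh: "PE \<inter> dom \<Sigma> = {}"
    and N: "domain N = domain M" "precs N \<subseteq> precs M"
      "\<And>\<pi> p. p \<notin> PE \<Longrightarrow> interp N \<pi> p = interp M \<pi> p"
    and over: "fm_over \<Sigma> \<phi>"
    and dia: "\<And>\<psi> f u. Diamond \<psi> \<in> subfms \<phi> \<Longrightarrow> f \<in> stable_perms PE N \<Longrightarrow> range u \<subseteq> domain M \<Longrightarrow>
      (\<exists>\<pi>'\<in>precs N. \<exists>g\<in>stable_perms PE N. \<exists>u'. range u' \<subseteq> domain M \<and> g \<circ> u' = f \<circ> u \<and> sat M \<pi>' u' \<psi>)
      \<longleftrightarrow> (\<exists>\<pi>'\<in>precs M. sat M \<pi>' u \<psi>)"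
    and "\<pi> \<in> precs N" "f \<in> stable_perms PE N" "range u \<subseteq> domain M"
  shows "sat (perm_closure PE N) (\<pi>, f) (f \<circ> u) \<phi> \<longleftrightarrow> sat M \<pi> u \<phi>"
  \<comment> \<open>The facts \<open>over\<close> and \<open>dia\<close> speak of the formula, so
    they must enter the induction to be passed on to subformulae.\<close>
  using over dia assms(8-10)
proof (induction \<phi> arbitrary: \<pi> f u)
  case (Atom p ts)
  have bij: "bij_betw f (domain M) (domain M)"
    using Atom.prems N(1) by (simp add: stable_perms_def)
  have p: "\<Sigma> p = Some (length ts)" "p \<notin> PE"
    using Atom.prems fresh by auto
  \<comment> \<open>As \<open>f\<close> is injective only on the domain, \<open>map f\<close> can be
    cancelled only for tuples over the domain.\<close>
  have sub: "interp M \<pi> p \<subseteq> lists (domain M)"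
  proof -
    have "\<pi> \<in> precs M" using Atom.prems(3) N(2) by blast
    then have "interp M \<pi> p \<subseteq> {ds. length ds = length ts \<and> set ds \<subseteq> domain M}"
      using M p(1) by (simp add: sstruct_over_def)
    then show ?thesis by auto
  qed
  have "inj_on (map f) (lists (domain M))"
    using bij by (simp add: bij_betw_def inj_on_mapI inj_on_map_lists)
  moreover have "map u ts \<in> lists (domain M)"
    using Atom.prems(5) by (auto simp: range_subsetD)
  ultimately have "map f (map u ts) \<in> map f ` interp M \<pi> p \<longleftrightarrow> map u ts \<in> interp M \<pi> p"
    using sub by (meson inj_on_image_mem_iff)
  then show ?case
    using p N(3) by (simp add: perm_closure_def comp_def)
next
  case (Eq s t)
  have "inj_on f (domain M)"
    using Eq.prems N(1) by (simp add: stable_perms_def bij_betw_def)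
  then show ?case
    using inj_on_eq_iff[of f "domain M" "u s" "u t"] Eq.prems(5) by (auto simp: range_subsetD)
next
  case (Neg \<phi>)
  have "sat (perm_closure PE N) (\<pi>, f) (f \<circ> u) \<phi> \<longleftrightarrow> sat M \<pi> u \<phi>"
    by (rule Neg.IH) (use Neg.prems in auto)
  then show ?case by (simp add: comp_def)
next
  case (Conj \<phi> \<psi>)
  have "sat (perm_closure PE N) (\<pi>, f) (f \<circ> u) \<phi> \<longleftrightarrow> sat M \<pi> u \<phi>"
    by (rule Conj.IH(1)) (use Conj.prems in auto)
  moreover have "sat (perm_closure PE N) (\<pi>, f) (f \<circ> u) \<psi> \<longleftrightarrow> sat M \<pi> u \<psi>"
    by (rule Conj.IH(2)) (use Conj.prems in auto)
  ultimately show ?case by (simp add: comp_def)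
next
  case (ExCount c n z \<phi>)
  have bij: "bij_betw f (domain M) (domain M)"
    using ExCount.prems N(1) by (simp add: stable_perms_def)
  have step: "sat (perm_closure PE N) (\<pi>, f) ((f \<circ> u)(z := f d)) \<phi> \<longleftrightarrow> sat M \<pi> (u(z := d)) \<phi>"
    if "d \<in> domain M" for d
  proof -
    have "sat (perm_closure PE N) (\<pi>, f) (f \<circ> u(z := d)) \<phi> \<longleftrightarrow> sat M \<pi> (u(z := d)) \<phi>"
      by (rule ExCount.IH) (use ExCount.prems that in \<open>auto split: if_splits\<close>)
    then show ?thesis by (simp only: fun_upd_comp)
  qed
  \<comment> \<open>Every value of the bound variable has the form \<open>f d\<close>, because
    \<open>f\<close> is onto the domain.\<close>
  have "{d \<in> domain M. sat (perm_closure PE N) (\<pi>, f) ((f \<circ> u)(z := d)) \<phi>}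
      = f ` {d \<in> domain M. sat M \<pi> (u(z := d)) \<phi>}" (is "?L = f ` ?R")
  proof -
    have "d \<in> f ` ?R" if "d \<in> ?L" for d
    proof -
      have "d \<in> f ` domain M"
        using that bij_betw_imp_surj_on[OF bij] by simp
      then obtain e where e: "e \<in> domain M" "d = f e" by blast
      then have "e \<in> ?R" using that step[OF e(1)] by simp
      then show ?thesis using e(2) by blast
    qed
    moreover have "f e \<in> ?L" if "e \<in> ?R" for e
      using that step[of e] bij_betwE[OF bij] by simp
    ultimately show ?thesis by blast
  qed
  moreover have "inj_on f {d \<in> domain M. sat M \<pi> (u(z := d)) \<phi>}"
    using bij by (auto simp: bij_betw_def inj_on_def)
  moreover have "domain (perm_closure PE N) = domain M"
    by (simp add: perm_closure_def N(1))
  ultimately show ?case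
    by (simp add: has_count_image comp_def)
next
  case (Diamond \<psi>)
  have IH: "sat (perm_closure PE N) (\<pi>', g) (g \<circ> u') \<psi> \<longleftrightarrow> sat M \<pi>' u' \<psi>"
    if "\<pi>' \<in> precs N" "g \<in> stable_perms PE N" "range u' \<subseteq> domain M" for \<pi>' g u'
    by (rule Diamond.IH) (use Diamond.prems that in auto)
  \<comment> \<open>The diamond changes the permutation to \<open>g\<close> but keeps the values
    \<open>f \<circ> u\<close>. To apply \<open>IH\<close> they are rewritten as
    \<open>g \<circ> u'\<close>, with \<open>u'\<close> the composition of
    \<open>f \<circ> u\<close> with the inverse of \<open>g\<close>.\<close>
  have factor: "\<exists>u'. range u' \<subseteq> domain M \<and> g \<circ> u' = f \<circ> u" if "g \<in> stable_perms PE N" for g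
  proof -
    have bij: "bij_betw f (domain M) (domain M)" "bij_betw g (domain M) (domain M)"
      using Diamond.prems that N(1) by (auto simp: stable_perms_def)
    have "f (u z) \<in> g ` domain M" for z
      using bij Diamond.prems by (metis bij_betw_def imageI range_subsetD)
    then have "range (inv_into (domain M) g \<circ> (f \<circ> u)) \<subseteq> domain M"
      "g \<circ> (inv_into (domain M) g \<circ> (f \<circ> u)) = f \<circ> u"
      by (auto simp: inv_into_into f_inv_into_f fun_eq_iff)
    then show ?thesis by blast
  qed
  have "sat (perm_closure PE N) (\<pi>, f) (f \<circ> u) (Diamond \<psi>) \<longleftrightarrow>
      (\<exists>\<pi>'\<in>precs N. \<exists>g\<in>stable_perms PE N. sat (perm_closure PE N) (\<pi>', g) (f \<circ> u) \<psi>)"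
    by (auto simp: perm_closure_def comp_def)
  also have "\<dots> \<longleftrightarrow> (\<exists>\<pi>'\<in>precs N. \<exists>g\<in>stable_perms PE N.
      \<exists>u'. range u' \<subseteq> domain M \<and> g \<circ> u' = f \<circ> u \<and> sat M \<pi>' u' \<psi>)"
    using IH factor by metis
  also have "\<dots> \<longleftrightarrow> (\<exists>\<pi>'\<in>precs M. sat M \<pi>' u \<psi>)"
    by (rule Diamond.prems(2)) (use Diamond.prems in auto)
  finally show ?case by (simp add: comp_def)
qed

section \<open>Diamond types of domain elements\<close>

text \<open>The constant assignment avoids naming the free variable, which may differ from one
  diamond to another. The truth of a diamond does not depend on the precisification, so neither does
  the type.\<close>

definition dia_type :: "('d, 'w, 'p) sstruct \<Rightarrow> ('p, 'v) fm \<Rightarrow> 'd \<Rightarrow> ('p, 'v) fm set" where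
  "dia_type M \<phi> \<delta> = {\<chi> \<in> Dia \<phi>. \<exists>\<pi>\<in>precs M. sat M \<pi> (\<lambda>_. \<delta>) \<chi>}"

lemma Diamond_in_dia_type:
  assumes "Diamond \<psi> \<in> subfms \<phi>" "fv \<psi> \<subseteq> {z}"
  shows "Diamond \<psi> \<in> dia_type M \<phi> (u z) \<longleftrightarrow> (\<exists>\<pi>\<in>precs M. sat M \<pi> u \<psi>)"
proof -
  have "sat M \<pi> (\<lambda>_. u z) \<psi> \<longleftrightarrow> sat M \<pi> u \<psi>" for \<pi>
    by (rule sat_cong) (use assms in auto)
  then show ?thesis using assms by (auto simp: dia_type_def Dia_def)
qed

lemma monodic_fv:
  assumes "monodic \<phi>" "Diamond \<psi> \<in> subfms \<phi>"
  obtains z where "fv \<psi> \<subseteq> {z}"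
proof -
  have "card (fv \<psi>) \<le> 1" using assms by (simp add: monodic_def)
  then have "\<forall>a\<in>fv \<psi>. \<forall>b\<in>fv \<psi>. a = b"
    by (simp add: card_le_Suc0_iff_eq)
  then have "\<exists>z. fv \<psi> \<subseteq> {z}" by blast
  then show ?thesis using that by blast
qed

text \<open>In a monodic formula a diamond outside \<open>FreeDia \<phi>\<close> is closed, hence
  has the same truth value at all elements. This is why one predicate per element of
  \<open>FreeDia \<phi>\<close> suffices to fix the type.\<close>

lemma dia_type_eqI:
  assumes "monodic \<phi>"
    and "\<And>\<chi>. \<chi> \<in> FreeDia \<phi> \<Longrightarrow> \<chi> \<in> dia_type M \<phi> a \<longleftrightarrow> \<chi> \<in> dia_type M \<phi> b"
  shows "dia_type M \<phi> a = dia_type M \<phi> b"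
proof -
  have "\<chi> \<in> dia_type M \<phi> a \<longleftrightarrow> \<chi> \<in> dia_type M \<phi> b" if \<chi>: "\<chi> \<in> Dia \<phi>" for \<chi>
  proof (cases "\<chi> \<in> FreeDia \<phi>")
    case False
    obtain \<psi> where \<psi>: "\<chi> = Diamond \<psi>" "Diamond \<psi> \<in> subfms \<phi>"
      using \<chi> by (auto simp: Dia_def)
    have "card (fv \<psi>) \<le> 1" "card (fv \<psi>) \<noteq> 1"
      using False \<chi> \<psi> assms(1) by (auto simp: FreeDia_def monodic_def)
    then have "card (fv \<psi>) = 0" by linarith
    then have "fv \<psi> = {}" by simp
    then have "sat M \<pi> (\<lambda>_. a) \<chi> \<longleftrightarrow> sat M \<pi> (\<lambda>_. b) \<chi>" for \<pi>
      using \<psi>(1) by (intro sat_cong) simp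
    then show ?thesis by (simp add: dia_type_def)
  qed (use assms in auto)
  then show ?thesis by (auto simp: dia_type_def)
qed

section \<open>Finitely many witnessing precisifications\<close>

text \<open>Witnesses are chosen for pairs of a diamond and a set of diamonds, and the bound counts
  these pairs. The choice can be independent of \<open>\<delta>\<close> because the body of the
  diamond need only hold at some element of the same type.\<close>

lemma exists_witness_precs:
  fixes M :: "('d, 'w, 'p) sstruct" and \<phi> :: "('p, 'v) fm"
  assumes "precs M \<noteq> {}" "monodic \<phi>"
  obtains W where "W \<subseteq> precs M" "W \<noteq> {}" "finite W"
    "card W \<le> max 1 (card (Dia \<phi>) * 2 ^ card (Dia \<phi>))"
    "\<And>\<delta> \<psi>. \<delta> \<in> domain M \<Longrightarrow> Diamond \<psi> \<in> dia_type M \<phi> \<delta> \<Longrightarrow>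
       \<exists>\<pi>\<in>W. \<exists>\<delta>'\<in>domain M. dia_type M \<phi> \<delta>' = dia_type M \<phi> \<delta> \<and> sat M \<pi> (\<lambda>_. \<delta>') \<psi>"
proof (cases "Dia \<phi> = {}")
  case True
  \<comment> \<open>Without diamonds no witness is required, but the set of precisifications must be
    nonempty; hence the \<open>max 1\<close> in the bound.\<close>
  obtain \<pi>0 where "\<pi>0 \<in> precs M" using assms by blast
  with True show ?thesis by (intro that[of "{\<pi>0}"]) (auto simp: dia_type_def)
next
  case False
  define wit where "wit = (\<lambda>(\<chi> :: ('p, 'v) fm) S \<pi>. \<exists>\<psi>. \<chi> = Diamond \<psi> \<and>
    (\<exists>\<delta>'\<in>domain M. dia_type M \<phi> \<delta>' = S \<and> sat M \<pi> (\<lambda>_. \<delta>') \<psi>))"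
  \<comment> \<open>The implication makes the choice total: a pair without a witness receives an
    arbitrary precisification of \<open>M\<close>.\<close>
  have "\<exists>\<pi>. \<pi> \<in> precs M \<and> ((\<exists>\<pi>'\<in>precs M. wit (fst c) (snd c) \<pi>') \<longrightarrow> wit (fst c) (snd c) \<pi>)" for c
    using assms by blast
  then obtain w where w: "\<And>c. w c \<in> precs M"
    "\<And>\<chi> S \<pi>. \<pi> \<in> precs M \<Longrightarrow> wit \<chi> S \<pi> \<Longrightarrow> wit \<chi> S (w (\<chi>, S))"
    by (metis fst_conv snd_conv)
  let ?C = "Dia \<phi> \<times> Pow (Dia \<phi>)"
  show ?thesis
  proof (rule that[of "w ` ?C"])
    have "card (w ` ?C) \<le> card (Dia \<phi>) * 2 ^ card (Dia \<phi>)"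
      by (metis card_image_le card_cartesian_product card_Pow finite_Dia finite_Pow_iff
          finite_cartesian_product)
    then show "card (w ` ?C) \<le> max 1 (card (Dia \<phi>) * 2 ^ card (Dia \<phi>))" by simp
    fix \<delta> \<psi>
    assume \<delta>: "\<delta> \<in> domain M" and \<psi>: "Diamond \<psi> \<in> dia_type M \<phi> \<delta>"
    let ?c = "(Diamond \<psi>, dia_type M \<phi> \<delta>)"
    obtain \<pi> where "\<pi> \<in> precs M" "wit (Diamond \<psi>) (dia_type M \<phi> \<delta>) \<pi>"
      using \<delta> \<psi> by (auto simp: dia_type_def wit_def)
    then have "wit (Diamond \<psi>) (dia_type M \<phi> \<delta>) (w ?c)" by (rule w(2))
    moreover have "?c \<in> ?C" using \<psi> by (auto simp: dia_type_def)
    ultimately show "\<exists>\<pi>\<in>w ` ?C. \<exists>\<delta>'\<in>domain M. dia_type M \<phi> \<delta>' = dia_type M \<phi> \<delta> \<and> sat M \<pi> (\<lambda>_. \<delta>') \<psi>"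
      unfolding wit_def by blast
  qed (use w(1) False in auto)
qed

theorem theorem4:
  fixes \<Sigma> :: "'p sig" and x y :: 'v and \<phi> :: "('p, 'v) fm"
  assumes fresh_supply: "infinite (- dom \<Sigma>)"
    and "x \<noteq> y"
    and "frugal_monodic_C2 \<Sigma> x y \<phi>"
    and "satisfiable TYPE('d) TYPE('w) \<Sigma> \<phi>"
  shows "\<exists>(PE :: 'p set) (M :: ('d, 'w, 'p) sstruct).
           PE \<inter> dom \<Sigma> = {} \<and>
           finite PE \<and> card PE = card (FreeDia \<phi>) \<and>
           sstruct_over (add_unary \<Sigma> PE) M \<and>
           (\<forall>E\<in>PE. rigid M E) \<and>
           finite (precs M) \<and> card (precs M) \<le> max 1 (card (Dia \<phi>) * 2 ^ card (Dia \<phi>)) \<and>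
           models (perm_closure PE M) \<phi>"
proof -
  have over: "fm_over \<Sigma> \<phi>" and mono: "monodic \<phi>"
    using assms(3) by (auto simp: frugal_monodic_C2_def)
  obtain M :: "('d, 'w, 'p) sstruct" where M: "sstruct_over \<Sigma> M" and model: "models M \<phi>"
    using assms(4) by (auto simp: satisfiable_def)
  obtain PE where PE: "PE \<subseteq> - dom \<Sigma>" "finite PE" "card PE = card (FreeDia \<phi>)"
    using infinite_arbitrarily_large[OF fresh_supply] by blast
  then have fresh: "PE \<inter> dom \<Sigma> = {}" by blast
  obtain h where h: "bij_betw h PE (FreeDia \<phi>)"
    using finite_same_card_bij[OF PE(2) finite_FreeDia PE(3)] by blast
  have "precs M \<noteq> {}" using M by (simp add: sstruct_over_def)
  then obtain W where W: "W \<subseteq> precs M" "W \<noteq> {}" "finite W"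
    "card W \<le> max 1 (card (Dia \<phi>) * 2 ^ card (Dia \<phi>))"
    and wit: "\<And>\<delta> \<psi>. \<delta> \<in> domain M \<Longrightarrow> Diamond \<psi> \<in> dia_type M \<phi> \<delta> \<Longrightarrow>
       \<exists>\<pi>\<in>W. \<exists>\<delta>'\<in>domain M. dia_type M \<phi> \<delta>' = dia_type M \<phi> \<delta> \<and> sat M \<pi> (\<lambda>_. \<delta>') \<psi>"
    using exists_witness_precs[OF _ mono] by metis
  \<comment> \<open>The fresh predicate \<open>E\<close> stands for the diamond \<open>h E\<close>.
    It is evaluated in \<open>M\<close>, so types remain those of the original model after
    precisifications are discarded.\<close>
  define R where "R E = {[\<delta>] |\<delta>. \<delta> \<in> domain M \<and> h E \<in> dia_type M \<phi> \<delta>}" for E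
  define N where "N = \<lparr>domain = domain M, precs = W,
    interp = (\<lambda>\<pi> p. if p \<in> PE then R p else interp M \<pi> p)\<rparr>"
  have N: "domain N = domain M" "precs N = W"
    "\<And>\<pi> p. interp N \<pi> p = (if p \<in> PE then R p else interp M \<pi> p)"
    by (auto simp: N_def)
  have rigid_R: "rigid_interp N E = R E" if "E \<in> PE" for E
    using that W by (intro rigid_interp_eq) (auto simp: N)
  have same_type: "dia_type M \<phi> a = dia_type M \<phi> b"
    if "a \<in> domain M" "b \<in> domain M" "\<And>E. E \<in> PE \<Longrightarrow> [a] \<in> rigid_interp N E \<longleftrightarrow> [b] \<in> rigid_interp N E"
    for a b
  proof (rule dia_type_eqI[OF mono])
    fix \<chi> assume "\<chi> \<in> FreeDia \<phi>"
    then obtain E where "E \<in> PE" "\<chi> = h E" using h by (auto simp: bij_betw_def)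
    then show "\<chi> \<in> dia_type M \<phi> a \<longleftrightarrow> \<chi> \<in> dia_type M \<phi> b"
      using that rigid_R by (auto simp: R_def)
  qed
  have perm_type: "f \<delta> \<in> domain M \<and> dia_type M \<phi> (f \<delta>) = dia_type M \<phi> \<delta>"
    if "f \<in> stable_perms PE N" "\<delta> \<in> domain M" for f \<delta>
  proof
    show "f \<delta> \<in> domain M"
      using that by (auto simp: stable_perms_def N bij_betw_def)
    then show "dia_type M \<phi> (f \<delta>) = dia_type M \<phi> \<delta>"
      using that by (intro same_type) (auto simp: stable_perms_def N)
  qed
  \<comment> \<open>This is the diamond hypothesis of \<open>sat_perm_closure\<close>. Monodicity
    reduces both sides to the type of the value at a single variable \<open>z\<close>.\<close>
  have dia: "(\<exists>\<pi>'\<in>W. \<exists>g\<in>stable_perms PE N. \<exists>u'. range u' \<subseteq> domain M \<and> g \<circ> u' = f \<circ> u \<and> sat M \<pi>' u' \<psi>)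
      \<longleftrightarrow> (\<exists>\<pi>'\<in>precs M. sat M \<pi>' u \<psi>)" (is "?L \<longleftrightarrow> ?R")
    if \<psi>: "Diamond \<psi> \<in> subfms \<phi>" and f: "f \<in> stable_perms PE N" and u: "range u \<subseteq> domain M"
    for \<psi> f and u :: "'v \<Rightarrow> 'd"
  proof -
    obtain z where z: "fv \<psi> \<subseteq> {z}" using monodic_fv[OF mono \<psi>] .
    note in_type = Diamond_in_dia_type[OF \<psi> z, of M]
    have fu: "f (u z) \<in> domain M" "dia_type M \<phi> (f (u z)) = dia_type M \<phi> (u z)"
      using perm_type[OF f] u by auto
    show ?thesis
    proof
      assume ?L
      then obtain \<pi>' g u' where L: "\<pi>' \<in> W" "g \<in> stable_perms PE N" "range u' \<subseteq> domain M"
        "g \<circ> u' = f \<circ> u" "sat M \<pi>' u' \<psi>" by blast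
      \<comment> \<open>No discarded or permuted precisification adds a true diamond:
        \<open>u' z\<close>, \<open>g (u' z) = f (u z)\<close> and \<open>u z\<close> all have the
        same type.\<close>
      have "Diamond \<psi> \<in> dia_type M \<phi> (u' z)"
        using L W(1) in_type by blast
      moreover have "dia_type M \<phi> (u' z) = dia_type M \<phi> (g (u' z))"
        using perm_type[OF L(2)] L(3) by auto
      moreover have "g (u' z) = f (u z)"
        using L(4) by (metis comp_apply)
      ultimately show ?R using fu in_type by auto
    next
      assume ?R
      then have "Diamond \<psi> \<in> dia_type M \<phi> (f (u z))"
        using in_type fu by auto
      then obtain \<pi>' \<delta>' where \<delta>': "\<pi>' \<in> W" "\<delta>' \<in> domain M"
        "dia_type M \<phi> \<delta>' = dia_type M \<phi> (f (u z))" "sat M \<pi>' (\<lambda>_. \<delta>') \<psi>"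
        using wit fu(1) by metis
      \<comment> \<open>The witness \<open>\<delta>'\<close> shares its type with
        \<open>f (u z)\<close>, so exchanging the two is stable. The involution cancels in
        \<open>?g \<circ> ?u'\<close>, and \<open>?u'\<close> sends \<open>z\<close> to
        \<open>\<delta>'\<close>; its values at other variables do not affect
        \<open>\<psi>\<close>.\<close>
      let ?g = "restrict (transpose \<delta>' (f (u z))) (domain M)"
      let ?u' = "transpose \<delta>' (f (u z)) \<circ> (f \<circ> u)"
      have "?g \<in> stable_perms PE N"
        using transpose_stable[of \<delta>' N "f (u z)" PE] \<delta>' fu rigid_R by (auto simp: N R_def)
      moreover have ran: "range ?u' \<subseteq> domain M"
        using perm_type[OF f] u \<delta>' fu by (auto simp: transpose_def)
      moreover have "?g \<circ> ?u' = f \<circ> u"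
        using ran by (auto simp: fun_eq_iff)
      moreover have "sat M \<pi>' ?u' \<psi> \<longleftrightarrow> sat M \<pi>' (\<lambda>_. \<delta>') \<psi>"
        by (rule sat_cong) (use z in auto)
      ultimately show ?L using \<delta>' by blast
    qed
  qed
  have "models (perm_closure PE N) \<phi>"
    unfolding models_def
  proof (intro ballI allI impI)
    fix c and v :: "'v \<Rightarrow> 'd"
    assume c: "c \<in> precs (perm_closure PE N)" and "range v \<subseteq> domain (perm_closure PE N)"
    then have v: "range v \<subseteq> domain M" by (simp add: perm_closure_def N)
    obtain \<pi> f where \<pi>: "c = (\<pi>, f)" "\<pi> \<in> W" and f: "f \<in> stable_perms PE N"
      using c by (auto simp: perm_closure_def N)
    have surj: "f ` domain M = domain M"
      using f by (auto simp: stable_perms_def N bij_betw_def)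
    \<comment> \<open>Surjectivity of \<open>f\<close> writes an arbitrary assignment
      \<open>v\<close> as \<open>f \<circ> ?u\<close>, the form required by
      \<open>sat_perm_closure\<close>.\<close>
    let ?u = "inv_into (domain M) f \<circ> v"
    have u: "range ?u \<subseteq> domain M" "f \<circ> ?u = v"
      using v surj by (auto simp: fun_eq_iff inv_into_into f_inv_into_f range_subsetD)
    have "sat (perm_closure PE N) (\<pi>, f) (f \<circ> ?u) \<phi> \<longleftrightarrow> sat M \<pi> ?u \<phi>"
      by (rule sat_perm_closure[OF M fresh _ _ _ over]) (use N W \<pi> f u dia in auto)
    then show "sat (perm_closure PE N) c v \<phi>"
      using model \<pi> W(1) u unfolding models_def by auto
  qed
  moreover have "sstruct_over (add_unary \<Sigma> PE) N"
    using M W by (auto simp: sstruct_over_def N add_unary_def R_def subset_iff split: if_splits)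
  moreover have "\<forall>E\<in>PE. rigid N E"
    by (simp add: rigid_def N)
  ultimately show ?thesis
    using fresh PE(2,3) W(3,4) N(2) by blast
qed

end
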